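(* Suppose that $\lambda^{<\kappa}=\lambda$ and let $U$ be a normal fine ultrafilter over $P_\kappa(\lambda)$. Then for any ${\langle} A_\alpha\mid \alpha<\lambda^+{\rangle}\subseteq U$ there are sets $H_x\in [\lambda^+]^{\lambda^+}$ for $x\in P_\kappa(\lambda)$ such that for every choice ${\langle}\alpha_x\mid x\in P_\kappa(\lambda){\rangle}\in \prod_{x\in P_\kappa(\lambda)}H_x$, the cone intersection of ${\langle} A_{\alpha_x}\mid x\in P_\kappa(\lambda){\rangle}$, namely the set $\{y\in P_\kappa(\lambda)\mid \forall x\in P_\kappa(\lambda),\ (x\prec y\vee y\subseteq x)\Rightarrow y\in A_{\alpha_x}\}$, belongs to $U$.
   Context: $\kappa\leq\lambda$ are cardinals and $P_\kappa(\lambda)=\{x\subseteq\lambda : |x|<\kappa\}$. For $x,y\in P_\kappa(\lambda)$, $x\prec y$ ("$x$ is strongly below $y$") means $x\subseteq y$ and $|x|<|\kappa\cap y|$. An ultrafilter $U$ on $P_\kappa(\lambda)$ is fine if $\{x\in P_\kappa(\lambda):\alpha\in x\}\in U$ for every $\alpha<\lambda$, and normal if it is closed under diagonal intersections $\triangle_{\alpha<\lambda}X_\alpha=\{x\in P_\kappa(\lambda):\forall\alpha\in x\,(x\in X_\alpha)\}$. $[\lambda^+]^{\lambda^+}$ denotes the subsets of $\lambda^+$ of cardinality $\lambda^+$. For a sequence ${\langle} A_x\mid x\in P_\kappa(\lambda){\rangle}$ of subsets of $P_\kappa(\lambda)$, its cone intersection is $\{y\in P_\kappa(\lambda)\mid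 \forall x\in P_\kappa(\lambda),\ (x\prec y\vee y\subseteq x)\Rightarrow y\in A_x\}$.
   Formalization: It is assumed explicitly that U is κ-complete (closed under intersections of fewer than κ of its members), as is usual for normal fine ultrafilters; without this the claim can fail, e.g. for U induced on P_κ(λ) with κ=λ=δ⁺ by a normal fine ultrafilter over P_δ(λ), when 2^δ=δ⁺. *)

theory Defs
  imports Main
begin

unbundle cardinal_syntax

text \<open>
  A cardinal \<open>\<lambda>\<close> is a cardinal order \<open>l\<close> in the sense of \<open>Card_order\<close>; the ordinals below
  \<open>\<lambda>\<close> are the elements of \<open>Field l\<close>, and \<open>\<lambda>\<^sup>+\<close> is \<open>cardSuc l\<close>.  As with von Neumann
  ordinals, a cardinal \<open>\<kappa> \<le> \<lambda>\<close> is an initial segment \<open>K\<close> of \<open>Field l\<close> (\<open>K = Field l\<close> is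
  allowed), so that \<open>\<kappa> \<inter> y\<close> makes sense for \<open>y \<subseteq> \<lambda>\<close>.  The ordinals below \<open>\<kappa>\<close> are then the
  proper initial segments \<open>underS l a\<close> with \<open>a \<in> K\<close>.
\<close>

definition initial_cardinal :: "'a rel \<Rightarrow> 'a set \<Rightarrow> bool" where
  "initial_cardinal l K \<longleftrightarrow> Order_Relation.ofilter l K \<and> Card_order (Restr l K)"

text \<open>\<open>\<lambda>\<close> to the power \<open>< \<kappa>\<close>: the number of sequences in \<open>\<lambda>\<close> whose length is an ordinal below
  \<open>\<kappa>\<close>.  The disjoint sum keeps sequences of different lengths apart.\<close>

definition power_below :: "'a rel \<Rightarrow> 'a set \<Rightarrow> ('a \<times> ('a \<Rightarrow> 'a)) rel" where
  "power_below l K = |SIGMA a : K. Func (underS l a) (Field l)|"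

definition P_below :: "'a rel \<Rightarrow> 'a set \<Rightarrow> 'a set set" where
  "P_below l K = {x. x \<subseteq> Field l \<and> |x| <o |K|}"

definition strongly_below :: "'a set \<Rightarrow> 'a set \<Rightarrow> 'a set \<Rightarrow> bool" where
  "strongly_below K x y \<longleftrightarrow> x \<subseteq> y \<and> |x| <o |K \<inter> y|"

definition ultrafilter_on :: "'b set \<Rightarrow> 'b set set \<Rightarrow> bool" where
  "ultrafilter_on S U \<longleftrightarrow>
     U \<subseteq> Pow S \<and> S \<in> U \<and> {} \<notin> U \<and>
     (\<forall>X\<in>U. \<forall>Y\<in>U. X \<inter> Y \<in> U) \<and>
     (\<forall>X\<in>U. \<forall>Y. X \<subseteq> Y \<and> Y \<subseteq> S \<longrightarrow> Y \<in> U) \<and>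
     (\<forall>X. X \<subseteq> S \<longrightarrow> X \<in> U \<or> S - X \<in> U)"

text \<open>Ultrafilters over \<open>P\<^sub>\<kappa>(\<lambda>)\<close> are \<open>\<kappa>\<close>-complete by the usual convention.  Fineness and closure
  under diagonal intersections do not imply this: a normal fine ultrafilter over \<open>P\<^sub>\<delta>(\<lambda>)\<close> with
  \<open>\<delta> < \<kappa>\<close> induces an ultrafilter over \<open>P\<^sub>\<kappa>(\<lambda>)\<close> with both properties.\<close>

definition complete_below :: "'a set \<Rightarrow> 'b set set \<Rightarrow> bool" where
  "complete_below K U \<longleftrightarrow> (\<forall>F. F \<subseteq> U \<and> F \<noteq> {} \<and> |F| <o |K| \<longrightarrow> \<Inter>F \<in> U)"

definition fine :: "'a rel \<Rightarrow> 'a set \<Rightarrow> 'a set set set \<Rightarrow> bool" where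
  "fine l K U \<longleftrightarrow> (\<forall>a\<in>Field l. {x \<in> P_below l K. a \<in> x} \<in> U)"

definition diagonal_intersection ::
    "'a rel \<Rightarrow> 'a set \<Rightarrow> ('a \<Rightarrow> 'a set set) \<Rightarrow> 'a set set" where
  "diagonal_intersection l K X = {x \<in> P_below l K. \<forall>a\<in>x. x \<in> X a}"

definition normal :: "'a rel \<Rightarrow> 'a set \<Rightarrow> 'a set set set \<Rightarrow> bool" where
  "normal l K U \<longleftrightarrow>
     (\<forall>X. (\<forall>a\<in>Field l. X a \<in> U) \<longrightarrow> diagonal_intersection l K X \<in> U)"

definition cone_intersection ::
    "'a rel \<Rightarrow> 'a set \<Rightarrow> ('a set \<Rightarrow> 'a set set) \<Rightarrow> 'a set set" where
  "cone_intersection l K A =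
     {y \<in> P_below l K. \<forall>x\<in>P_below l K. strongly_below K x y \<or> y \<subseteq> x \<longrightarrow> y \<in> A x}"

end

theory Submission
  imports Defs
begin

text \<open>
  The argument follows Galvin.  Completeness makes \<open>\<kappa>\<close> a strong limit, so for a fixed \<open>x\<close> the traces
  \<open>A\<^sub>\<alpha> \<inter> Pow x\<close> take at most \<open>\<lambda>\<close> values; as \<open>P\<^sub>\<kappa>(\<lambda>)\<close> has at most \<open>\<lambda>\<close> elements, a union bound gives an
  \<open>\<alpha>\<close> such that for every \<open>x\<close> the set \<open>H\<^sub>x\<close> of all \<open>\<beta>\<close> with \<open>A\<^sub>\<beta> \<inter> Pow x = A\<^sub>\<alpha> \<inter> Pow x\<close> has size
  \<open>\<lambda>\<^sup>+\<close>.  For \<open>y \<in> A\<^sub>\<alpha>\<close> the conditions with \<open>y \<subseteq> x\<close> then hold automatically, and those with \<open>x \<prec> y\<close> hold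
  for almost all \<open>y\<close>, because a function \<open>y \<mapsto> x\<^sub>y \<prec> y\<close> is constant on a set in \<open>U\<close>: enumerate \<open>x\<^sub>y\<close>
  along some \<open>\<delta>\<^sub>y \<in> \<kappa> \<inter> y\<close>; normality fixes \<open>\<delta>\<^sub>y\<close> and each entry of the enumeration, completeness the
  whole enumeration.
\<close>

locale normal_fine_ultrafilter =
  fixes l :: "'a rel" and K :: "'a set" and U :: "'a set set set"
  assumes card_l: "Card_order l"
    and initial: "initial_cardinal l K"
    and ultra: "ultrafilter_on (P_below l K) U"
    and complete: "complete_below K U"
    and fine: "fine l K U"
    and normal: "normal l K U"
begin

section \<open>The ultrafilter and its closure properties\<close>

abbreviation P :: "'a set set" where "P \<equiv> P_below l K"

lemma P_in_U: "P \<in> U"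
  and empty_notin_U: "{} \<notin> U"
  using ultra by (simp_all add: ultrafilter_on_def)

lemma U_subset: "X \<in> U \<Longrightarrow> X \<subseteq> P"
  using ultra unfolding ultrafilter_on_def by (meson PowD subsetD)

lemma Int_in_U: "X \<in> U \<Longrightarrow> Y \<in> U \<Longrightarrow> X \<inter> Y \<in> U"
  using ultra by (simp add: ultrafilter_on_def)

lemma superset_in_U: "X \<in> U \<Longrightarrow> X \<subseteq> Y \<Longrightarrow> Y \<subseteq> P \<Longrightarrow> Y \<in> U"
  using ultra unfolding ultrafilter_on_def by meson

lemma in_U_or_Diff: "X \<subseteq> P \<Longrightarrow> X \<in> U \<or> P - X \<in> U"
  using ultra by (simp add: ultrafilter_on_def)

lemma ex_in_U: "X \<in> U \<Longrightarrow> \<exists>y. y \<in> X"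
  using empty_notin_U by (cases "X = {}") auto

lemma well_l: "Well_order l"
  using card_l by (rule card_order_on_well_order_on)

lemma K_subset: "K \<subseteq> Field l"
  using initial by (simp add: initial_cardinal_def Order_Relation.ofilter_def)

lemma underS_subset_K: "a \<in> K \<Longrightarrow> underS l a \<subseteq> K"
  using initial unfolding initial_cardinal_def Order_Relation.ofilter_def underS_def under_def by auto

lemma Field_Restr_subset: "B \<subseteq> Field l \<Longrightarrow> Field (Restr l B) = B"
  using well_l by (intro Refl_Field_Restr2) (simp_all add: order_on_defs)

lemma complete_indexed:
  assumes "|I| <o |K|" "\<And>i. i \<in> I \<Longrightarrow> X i \<in> U"
  shows "{y \<in> P. \<forall>i\<in>I. y \<in> X i} \<in> U"
proof (cases "I = {}")
  case True
  then show ?thesis using P_in_U by simp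
next
  case False
  have "|X ` I| <o |K|"
    using card_of_image assms(1) by (rule ordLeq_ordLess_trans)
  then have "\<Inter>(X ` I) \<in> U"
    using complete[unfolded complete_below_def, rule_format, of "X ` I"] assms(2) False
    by (simp add: image_subset_iff)
  moreover from U_subset[OF this] have "\<Inter>(X ` I) \<subseteq> {y \<in> P. \<forall>i\<in>I. y \<in> X i}"
    by auto
  ultimately show ?thesis by (rule superset_in_U) blast
qed

section \<open>Fineness and completeness: \<kappa> is an infinite strong limit\<close>

lemma finite_subset_in_U:
  assumes "finite F" "F \<subseteq> Field l"
  shows "{y \<in> P. F \<subseteq> y} \<in> U"
  using assms
proof induction
  case empty
  then show ?case using P_in_U by simp
next
  case (insert a F)
  then have "{y \<in> P. F \<subseteq> y} \<inter> {y \<in> P. a \<in> y} \<in> U"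
    using fine by (intro Int_in_U) (auto simp: fine_def)
  moreover have "{y \<in> P. F \<subseteq> y} \<inter> {y \<in> P. a \<in> y} = {y \<in> P. insert a F \<subseteq> y}"
    by auto
  ultimately show ?case by simp
qed

text \<open>Otherwise fineness yields some \<open>y \<in> P\<close> containing all of
  \<open>K\<close>, whereas members of \<open>P\<close> are smaller than \<open>K\<close>.\<close>

lemma infinite_K: "infinite K"
proof
  assume "finite K"
  then have "{y \<in> P. K \<subseteq> y} \<in> U"
    using K_subset by (rule finite_subset_in_U)
  then obtain y where "y \<in> P" "K \<subseteq> y"
    using ex_in_U by fastforce
  then show False
    using card_of_mono1[of K y] not_ordLess_ordLeq[of "|y|" "|K|"] by (simp add: P_below_def)
qed

lemma empty_in_P: "{} \<in> P"
proof -
  have "\<not> |K| \<le>o |{} :: 'a set|"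
    using infinite_K card_of_empty3 by blast
  then have "|{} :: 'a set| <o |K|"
    using not_ordLeq_iff_ordLess[OF card_of_Well_order card_of_Well_order] by blast
  then show ?thesis by (simp add: P_below_def)
qed

text \<open>The ultrafilter decides each statement \<open>i \<in> f y\<close>, and completeness
  combines these fewer than \<kappa> decisions; \<open>s\<close> collects the positive ones.\<close>

lemma constant_trace:
  assumes "|I| <o |K|"
  shows "\<exists>s\<subseteq>I. {y \<in> P. f y \<inter> I = s} \<in> U"
proof -
  define X where "X i = {y \<in> P. i \<in> f y}" for i
  define s where "s = {i \<in> I. X i \<in> U}"
  have "{y \<in> P. \<forall>i\<in>I. y \<in> (if i \<in> s then X i else P - X i)} \<in> U"
  proof (rule complete_indexed[OF assms])
    fix i assume "i \<in> I"
    then show "(if i \<in> s then X i else P - X i) \<in> U"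
      using in_U_or_Diff[of "X i"] by (auto simp: s_def X_def)
  qed
  moreover have "{y \<in> P. \<forall>i\<in>I. y \<in> (if i \<in> s then X i else P - X i)} \<subseteq> {y \<in> P. f y \<inter> I = s}"
    by (auto simp: s_def X_def split: if_splits)
  ultimately have "{y \<in> P. f y \<inter> I = s} \<in> U"
    by (rule superset_in_U) blast
  moreover have "s \<subseteq> I" by (auto simp: s_def)
  ultimately show ?thesis by blast
qed

text \<open>Choosing \<open>g y \<in> K - y\<close> projects \<open>U\<close> to a non-principal \<open>\<kappa>\<close>-complete ultrafilter on \<open>\<kappa>\<close>.\<close>

lemma strong_limit:
  assumes "|I| <o |K|"
  shows "|Pow I| <o |K|"
proof (rule ccontr)
  assume "\<not> |Pow I| <o |K|"
  then have "|K| \<le>o |Pow I|"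
    using not_ordLess_iff_ordLeq[OF card_of_Well_order card_of_Well_order] by blast
  then obtain e where e: "inj_on e K" "e ` K \<subseteq> Pow I"
    using card_of_ordLeq by metis
  have "\<exists>a. a \<in> K \<and> a \<notin> y" if "y \<in> P" for y
    using that card_of_mono1[of K y] not_ordLess_ordLeq[of "|y|" "|K|"]
    by (auto simp: P_below_def)
  then obtain g where g: "\<And>y. y \<in> P \<Longrightarrow> g y \<in> K" "\<And>y. y \<in> P \<Longrightarrow> g y \<notin> y"
    by metis
  obtain s where s: "{y \<in> P. e (g y) \<inter> I = s} \<in> U"
    using constant_trace[OF assms, of "\<lambda>y. e (g y)"] by blast
  then obtain z where z: "z \<in> P" "e (g z) \<inter> I = s"
    using ex_in_U by fastforce
  \<comment> \<open>Injectivity of \<open>e\<close> forces \<open>g y = g z\<close> for almost all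
    \<open>y\<close>, while by fineness almost all \<open>y\<close> contain \<open>g z\<close>; this
    contradicts \<open>g y \<notin> y\<close>.\<close>
  have "g z \<in> Field l" using g z K_subset by blast
  then have "{y \<in> P. g z \<in> y} \<in> U"
    using fine by (simp add: fine_def)
  with s have "{y \<in> P. e (g y) \<inter> I = s} \<inter> {y \<in> P. g z \<in> y} \<in> U"
    by (rule Int_in_U)
  then obtain y where y: "y \<in> P" "e (g y) \<inter> I = s" "g z \<in> y"
    using ex_in_U by fastforce
  have "e (g y) = e (g z)"
    using y z g(1) e(2) by blast
  then have "g y = g z"
    using y z g(1) e(1) by (meson inj_onD)
  then show False using y g(2) by metis
qed

section \<open>Normality: regressive functions and the relation \<prec>\<close>

lemma regressive_constant:
  assumes "W \<in> U" "\<And>y. y \<in> W \<Longrightarrow> g y \<in> y"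
  shows "\<exists>a. {y \<in> W. g y = a} \<in> U"
proof (rule ccontr)
  assume none: "\<nexists>a. {y \<in> W. g y = a} \<in> U"
  have "P - {y \<in> W. g y = a} \<in> U" for a
    using in_U_or_Diff[of "{y \<in> W. g y = a}"] U_subset[OF assms(1)] none by blast
  then have "diagonal_intersection l K (\<lambda>a. P - {y \<in> W. g y = a}) \<in> U"
    using normal by (simp add: normal_def)
  with assms(1) have "W \<inter> diagonal_intersection l K (\<lambda>a. P - {y \<in> W. g y = a}) \<in> U"
    by (rule Int_in_U)
  \<comment> \<open>Since \<open>g y \<in> y\<close>, a member \<open>y\<close> would have to avoid
    the fibre over \<open>g y\<close>, in which it lies.\<close>
  moreover have "W \<inter> diagonal_intersection l K (\<lambda>a. P - {y \<in> W. g y = a}) = {}"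
    using assms(2) by (auto simp: diagonal_intersection_def)
  ultimately show False using empty_notin_U by simp
qed

lemma card_underS: "a \<in> K \<Longrightarrow> |underS l a| <o |K|"
proof -
  assume a: "a \<in> K"
  have F: "Field (Restr l K) = K" using K_subset by (rule Field_Restr_subset)
  have C: "Card_order (Restr l K)" using initial by (simp add: initial_cardinal_def)
  have "underS (Restr l K) a = underS l a"
    using underS_subset_K[OF a] a by (auto simp: underS_def)
  then have "|underS l a| <o Restr l K"
    using card_of_underS[OF C, of a] a F by simp
  moreover have "Restr l K =o |K|"
    using card_of_Field_ordIso[OF C] F by (simp add: ordIso_symmetric)
  ultimately show ?thesis by (rule ordLess_ordIso_trans)
qed

text \<open>Comparing \<open>|x|\<close> with the order type of \<open>B\<close> spares us the fact that \<open>\<kappa> \<inter> y\<close> is almost always an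
  initial segment of \<open>\<kappa>\<close>.\<close>

lemma bij_segment:
  assumes "B \<subseteq> Field l" "|x| <o |B|"
  shows "\<exists>a\<in>B. \<exists>h. bij_betw h (underS l a \<inter> B) x"
proof -
  let ?r = "Restr l B"
  have F: "Field ?r = B" using assms(1) by (rule Field_Restr_subset)
  have W: "Well_order ?r" using well_l by (rule Well_order_Restr)
  have "|x| <o ?r"
    using assms(2) card_of_least[of B ?r] W F by (metis ordLess_ordLeq_trans)
  then obtain a where a: "a \<in> B" "|x| =o Restr ?r (underS ?r a)"
    using ordLess_iff_ordIso_Restr[OF W card_of_Well_order[of x]] F by auto
  have u: "underS ?r a = underS l a \<inter> B"
    using a(1) by (auto simp: underS_def)
  have "underS ?r a \<subseteq> Field ?r"
    using underS_Field by (rule subsetI)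
  then have "Field (Restr ?r (underS ?r a)) = underS ?r a"
    using W by (intro Refl_Field_Restr2) (simp_all add: order_on_defs)
  moreover obtain f where "iso |x| (Restr ?r (underS ?r a)) f"
    using a(2) by (auto simp: ordIso_def)
  ultimately have "bij_betw f x (underS ?r a)"
    unfolding iso_def by (simp add: Field_card_of)
  then show ?thesis
    using a(1) u bij_betw_inv_into by metis
qed

lemma strongly_below_diagonal:
  assumes A: "\<And>x. x \<in> P \<Longrightarrow> A x \<in> U"
  shows "{y \<in> P. \<forall>x\<in>P. strongly_below K x y \<longrightarrow> y \<in> A x} \<in> U" (is "?D \<in> U")
proof (rule ccontr)
  assume "?D \<notin> U"
  then have "P - ?D \<in> U"
    using in_U_or_Diff[of ?D] by blast
  \<comment> \<open>Intersecting with \<open>A {}\<close> makes the witnesses \<open>x\<close> nonempty, so that they are images of \<open>underS l a\<close>.\<close>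
  define W where "W = (P - ?D) \<inter> A {}"
  have W: "W \<in> U"
    using \<open>P - ?D \<in> U\<close> A[OF empty_in_P] unfolding W_def by (rule Int_in_U)
  have "\<exists>x a h. x \<in> P \<and> x \<subseteq> y \<and> y \<notin> A x \<and> a \<in> K \<inter> y \<and> h ` underS l a = x" if y: "y \<in> W" for y
  proof -
    obtain x where x: "x \<in> P" "strongly_below K x y" "y \<notin> A x"
      using y unfolding W_def by blast
    then have "x \<noteq> {}" using y unfolding W_def by auto
    then obtain b where b: "b \<in> x" by blast
    have "K \<inter> y \<subseteq> Field l" using K_subset by blast
    then obtain a h where a: "a \<in> K \<inter> y" and h: "bij_betw h (underS l a \<inter> (K \<inter> y)) x"
      using bij_segment[of "K \<inter> y" x] x(2) unfolding strongly_below_def by blast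
    \<comment> \<open>\<open>K \<inter> y\<close> may have gaps below \<open>a\<close>; sending the
      missing indices to \<open>b \<in> x\<close> leaves the image unchanged.\<close>
    have "(\<lambda>i. if i \<in> K \<inter> y then h i else b) ` underS l a = x"
      using h b unfolding bij_betw_def by force
    with x a show ?thesis unfolding strongly_below_def
      by (intro exI[of _ x] exI[of _ a] exI[of _ "\<lambda>i. if i \<in> K \<inter> y then h i else b"] conjI) simp_all
  qed
  then obtain x a h where
    x: "\<And>y. y \<in> W \<Longrightarrow> x y \<in> P \<and> x y \<subseteq> y \<and> y \<notin> A (x y)" and
    a: "\<And>y. y \<in> W \<Longrightarrow> a y \<in> K \<inter> y" and
    h: "\<And>y. y \<in> W \<Longrightarrow> h y ` underS l (a y) = x y"
    by metis
  obtain d where "{y \<in> W. a y = d} \<in> U"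
    using regressive_constant[OF W, of a] a by blast
  then obtain V where V: "V \<in> U" and V_W: "\<And>y. y \<in> V \<Longrightarrow> y \<in> W" "\<And>y. y \<in> V \<Longrightarrow> a y = d"
    by blast
  from ex_in_U[OF V] obtain y0 where "y0 \<in> V" ..
  then have dK: "d \<in> K" using a V_W by blast
  \<comment> \<open>For a fixed index \<open>i\<close> the map from \<open>y\<close> to
    \<open>h y i\<close> is regressive, because \<open>x y \<subseteq> y\<close>.\<close>
  have "\<exists>v. {y \<in> V. h y i = v} \<in> U" if i: "i \<in> underS l d" for i
    using V
  proof (rule regressive_constant)
    fix y assume "y \<in> V"
    then have "h y i \<in> x y" using h[of y] V_W i by blast
    then show "h y i \<in> y" using x \<open>y \<in> V\<close> V_W by blast
  qed
  then obtain v where v: "\<And>i. i \<in> underS l d \<Longrightarrow> {y \<in> V. h y i = v i} \<in> U"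
    by metis
  \<comment> \<open>There are fewer than \<kappa> indices below \<open>d\<close>, so completeness
    fixes all entries at once and \<open>x y\<close> is the same set for every
    \<open>y \<in> Z\<close>.\<close>
  define Z where "Z = V \<inter> {y \<in> P. \<forall>i\<in>underS l d. y \<in> {y \<in> V. h y i = v i}}"
  have Z: "Z \<in> U"
    unfolding Z_def by (intro Int_in_U V complete_indexed card_underS dK v)
  have const: "x y = v ` underS l d" and Z_W: "y \<in> W" if y: "y \<in> Z" for y
  proof -
    show "y \<in> W" using y V_W by (simp add: Z_def)
    then have "x y = h y ` underS l d" using y h[of y] V_W by (simp add: Z_def)
    also have "\<dots> = v ` underS l d" using y by (intro image_cong) (auto simp: Z_def)
    finally show "x y = v ` underS l d" .
  qed
  from ex_in_U[OF Z] obtain z where z: "z \<in> Z" ..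
  \<comment> \<open>The common value of \<open>x y\<close> lies in \<open>P\<close>, so its
    \<open>A\<close>-set is in \<open>U\<close> and meets \<open>Z\<close>, contrary to
    \<open>y \<notin> A (x y)\<close>.\<close>
  then have "v ` underS l d \<in> P" using const[OF z] x[OF Z_W[OF z]] by simp
  then have "Z \<inter> A (v ` underS l d) \<in> U"
    by (intro Int_in_U Z A)
  from ex_in_U[OF this] obtain y where "y \<in> Z" "y \<in> A (v ` underS l d)" by blast
  then show False using const[of y] x[OF Z_W[of y]] by simp
qed

section \<open>Counting traces and large classes of indices\<close>

lemma card_P:
  assumes "power_below l K =o l"
  shows "|P| \<le>o l"
proof -
  let ?S = "SIGMA a : K. Func (underS l a) (Field l)"
  have "P \<subseteq> (\<lambda>(a, f). f ` underS l a) ` ?S"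
  proof
    fix x assume "x \<in> P"
    then have x: "x \<subseteq> Field l" "|x| <o |K|" by (auto simp: P_below_def)
    then obtain a h where a: "a \<in> K" and h: "bij_betw h (underS l a \<inter> K) x"
      using bij_segment[OF K_subset] by blast
    have "underS l a \<inter> K = underS l a"
      using underS_subset_K[OF a] by blast
    with h have hx: "h ` underS l a = x" by (simp add: bij_betw_def)
    \<comment> \<open>\<open>Func\<close> contains only functions that are \<open>undefined\<close>
      outside their domain.\<close>
    let ?f = "\<lambda>i. if i \<in> underS l a then h i else undefined"
    have "(a, ?f) \<in> ?S" using a hx x(1) by (auto simp: Func_def)
    moreover have "x = (\<lambda>(a, f). f ` underS l a) (a, ?f)" using hx by auto
    ultimately show "x \<in> (\<lambda>(a, f). f ` underS l a) ` ?S" by (rule rev_image_eqI)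
  qed
  from card_of_mono1[OF this] have "|P| \<le>o |?S|"
    using card_of_image by (rule ordLeq_transitive)
  then show ?thesis
    using assms unfolding power_below_def by (rule ordLeq_ordIso_trans)
qed

text \<open>The set \<open>H x\<close> of the theorem will be the class of the trace
  \<open>A \<alpha> \<inter> Pow x\<close>, with one \<alpha> serving all \<open>x\<close>.\<close>

definition trace_class :: "('a set \<Rightarrow> 'a set set) \<Rightarrow> 'a set \<Rightarrow> 'a set set \<Rightarrow> 'a set set" where
  "trace_class A x S = {\<beta> \<in> Field (cardSuc l). A \<beta> \<inter> Pow x = S}"

lemma large_trace_class:
  assumes "power_below l K =o l"
  shows "\<exists>\<alpha>\<in>Field (cardSuc l). \<forall>x\<in>P. |trace_class A x (A \<alpha> \<inter> Pow x)| =o cardSuc l"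
proof -
  have C: "Card_order (cardSuc l)" using card_l by (rule cardSuc_Card_order)
  have inf: "infinite (Field l)"
    using infinite_K K_subset finite_subset by blast
  define small where "small x = {S \<in> Pow (Pow x). |trace_class A x S| \<le>o l}" for x
  \<comment> \<open>The indices to avoid: those whose class is small at some \<open>x\<close>. The
    union runs over at most \<lambda> many \<open>x\<close>, at most \<lambda> traces for each and
    at most \<lambda> indices for each trace.\<close>
  define Bad where "Bad = (\<Union>x\<in>P. \<Union>S\<in>small x. trace_class A x S)"
  have "|Bad| \<le>o l"
    unfolding Bad_def
  proof (intro card_of_UNION_ordLeq_infinite_Field inf card_l card_P assms ballI)
    fix x assume "x \<in> P"
    \<comment> \<open>Traces on \<open>x\<close> are elements of \<open>Pow (Pow x)\<close>, so the
      strong limit property is applied twice.\<close>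
    then have "|Pow (Pow x)| <o |K|" by (auto simp: P_below_def intro!: strong_limit)
    moreover have "|K| \<le>o l"
      using card_of_mono1[OF K_subset] card_of_Field_ordIso[OF card_l] by (rule ordLeq_ordIso_trans)
    ultimately have "|Pow (Pow x)| \<le>o l"
      using ordLess_ordLeq_trans ordLess_imp_ordLeq by blast
    moreover have "|small x| \<le>o |Pow (Pow x)|"
      by (rule card_of_mono1) (auto simp: small_def)
    ultimately show "|small x| \<le>o l" using ordLeq_transitive by blast
  qed (auto simp: small_def)
  then have "|Bad| <o cardSuc l"
    using cardSuc_ordLeq_ordLess[OF card_l card_of_Card_order] by blast
  moreover have "cardSuc l =o |Field (cardSuc l)|"
    using card_of_Field_ordIso[OF C] by (rule ordIso_symmetric)
  ultimately have "|Bad| <o |Field (cardSuc l)|" by (rule ordLess_ordIso_trans)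
  then obtain \<alpha> where \<alpha>: "\<alpha> \<in> Field (cardSuc l)" "\<alpha> \<notin> Bad"
    using card_of_mono1[of "Field (cardSuc l)" Bad] not_ordLess_ordLeq by blast
  have "|trace_class A x (A \<alpha> \<inter> Pow x)| =o cardSuc l" if x: "x \<in> P" for x
  proof -
    let ?T = "trace_class A x (A \<alpha> \<inter> Pow x)"
    \<comment> \<open>\<alpha> belongs to its own class, so a small class would put it into
      \<open>Bad\<close>.\<close>
    have "\<alpha> \<in> ?T" using \<alpha>(1) by (simp add: trace_class_def)
    then have "\<not> |?T| \<le>o l"
      using \<alpha>(2) x by (auto simp: Bad_def small_def)
    then have "cardSuc l \<le>o |?T|"
      using cardSuc_least[OF card_l card_of_Card_order] card_l card_of_Well_order well_l
        not_ordLeq_iff_ordLess by blast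
    moreover have "|?T| \<le>o |Field (cardSuc l)|"
      by (rule card_of_mono1) (auto simp: trace_class_def)
    then have "|?T| \<le>o cardSuc l"
      using card_of_Field_ordIso[OF C] by (rule ordLeq_ordIso_trans)
    ultimately show ?thesis by (simp add: ordIso_iff_ordLeq)
  qed
  with \<alpha>(1) show ?thesis by blast
qed

lemma cone_intersection_in_U:
  assumes "B \<in> U" and A: "\<And>x. x \<in> P \<Longrightarrow> A x \<in> U"
    and trace: "\<And>x. x \<in> P \<Longrightarrow> A x \<inter> Pow x = B \<inter> Pow x"
  shows "cone_intersection l K A \<in> U"
proof -
  let ?D = "{y \<in> P. \<forall>x\<in>P. strongly_below K x y \<longrightarrow> y \<in> A x}"
  have "B \<inter> ?D \<in> U"
    using assms(1) strongly_below_diagonal[OF A] by (rule Int_in_U)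
  \<comment> \<open>If \<open>y \<subseteq> x\<close>, then \<open>y \<in> Pow x\<close>, and
    equality of traces carries \<open>y\<close> from \<open>B\<close> into
    \<open>A x\<close>.\<close>
  moreover have "B \<inter> ?D \<subseteq> cone_intersection l K A"
    using trace unfolding cone_intersection_def by blast
  ultimately show ?thesis
    by (rule superset_in_U) (auto simp: cone_intersection_def)
qed

end

theorem theorem4p10:
  fixes l :: "'a rel" and K :: "'a set" and U :: "'a set set set"
    and A :: "'a set \<Rightarrow> 'a set set"
  assumes "Card_order l"
    and "initial_cardinal l K"
    and "power_below l K =o l"
    and "ultrafilter_on (P_below l K) U"
    and "complete_below K U"
    and "fine l K U"
    and "normal l K U"
    and "\<forall>\<alpha>\<in>Field (cardSuc l). A \<alpha> \<in> U"
  shows "\<exists>H :: 'a set \<Rightarrow> 'a set set.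
    (\<forall>x\<in>P_below l K. H x \<subseteq> Field (cardSuc l) \<and> |H x| =o cardSuc l) \<and>
    (\<forall>c. (\<forall>x\<in>P_below l K. c x \<in> H x) \<longrightarrow>
         cone_intersection l K (\<lambda>x. A (c x)) \<in> U)"
proof -
  interpret normal_fine_ultrafilter l K U
    using assms by unfold_locales
  obtain \<alpha> where \<alpha>: "\<alpha> \<in> Field (cardSuc l)"
    and large: "\<forall>x\<in>P. |trace_class A x (A \<alpha> \<inter> Pow x)| =o cardSuc l"
    using large_trace_class[OF assms(3), of A] by blast
  let ?H = "\<lambda>x. trace_class A x (A \<alpha> \<inter> Pow x)"
  have "cone_intersection l K (\<lambda>x. A (c x)) \<in> U" if c: "\<forall>x\<in>P. c x \<in> ?H x" for c
  proof (rule cone_intersection_in_U)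
    show "A \<alpha> \<in> U" using assms(8) \<alpha> by blast
    show "A (c x) \<in> U" if "x \<in> P" for x
      using c that assms(8) by (auto simp: trace_class_def)
    show "A (c x) \<inter> Pow x = A \<alpha> \<inter> Pow x" if "x \<in> P" for x
      using c that by (auto simp: trace_class_def)
  qed
  moreover have "?H x \<subseteq> Field (cardSuc l)" for x
    by (auto simp: trace_class_def)
  ultimately show ?thesis using large by (intro exI[of _ ?H]) blast
qed

end
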